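(* Let $G=(V,E)$ be a water distribution system with reservoir nodes $V_{\mathrm r}$ and consumer nodes $V_{\mathrm c}$, and let reservoir heads $h_{V_{\mathrm r}}\in\mathbb{R}^{V_{\mathrm r}}$ and consumer demands $d\in\mathbb{R}^{V_{\mathrm c}}$ be given. Then there exists exactly one pair $(h_{V_{\mathrm c}},q)$ of consumer heads $h_{V_{\mathrm c}}\in\mathbb{R}^{V_{\mathrm c}}$ and flows $q\in\mathbb{R}^{E}$ such that the triple $(h,q,d)$, where $h\in\mathbb{R}^V$ is the vector with restrictions $h_{V_{\mathrm r}}$ to $V_{\mathrm r}$ and $h_{V_{\mathrm c}}$ to $V_{\mathrm c}$, is physically correct.
   Context: A water distribution system (WDS) is a finite, connected, symmetric directed graph $G=(V,E)$ with $V\neq\emptyset$, $E\neq\emptyset$, whose edges are ordered pairs of distinct nodes; $e_{vu}=(v,u)$ denotes the edge from $v$ to $u$, and symmetric means $e_{vu}\in E$ implies $e_{uv}\in E$. The node set is a disjoint union $V=V_{\mathrm r}\sqcup V_{\mathrm c}$ of a nonempty set $V_{\mathrm r}$ of reservoir nodes and a nonempty set $V_{\mathrm c}$ of consumer nodes. The neighborhood of $v$ is $\mathcal N(v)=\{u\in V: e_{vu}\in E \text{ or } e_{uv}\in E\}$. Each edge carries a resistance coefficient $r_{vu}=10.67\, l_{vu}\,\rho_{vu}^{-4.8704}\,\eta_{vu}^{-1.852}>0$, where the length $l_{vu}=l_{uv}>0$, diameter $\rho_{vu}=\rho_{uv}>0$ and roughness $\eta_{vu}=\eta_{uv}>0$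 are symmetric (so $r_{vu}=r_{uv}$), and $x=1.852$. A hydraulic state is a triple $(h,q,d)$ of heads $h=(h_v)_{v\in V}$, flows $q=(q_e)_{e\in E}$ (write $q_{vu}=q_{e_{vu}}$) and demands $d=(d_v)_{v\in V_{\mathrm c}}$; all entries are real numbers. It is called physically correct if and only if the following three conditions hold: (1) conservation of energy: $h_v-h_u=r_{vu}\,q_{vu}\,|q_{vu}|^{x-1}$ for all $v\in V$, $u\in\mathcal N(v)$; (2) conservation of mass: $\sum_{u\in\mathcal N(v)}q_{vu}=-d_v$ for all $v\in V_{\mathrm c}$; (3) conservation of flows: $q_{uv}=-q_{vu}$ for all $v\in V$, $u\in\mathcal N(v)$. *)

theory Defs
  imports "HOL-Analysis.Analysis" "Graph_Theory.Digraph_Component"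
begin

text \<open>
  Edges are ordered pairs of nodes, and (v, u) is the edge from v to u, so edge data such as
  \<open>q (v, u)\<close> stand for \<open>q\<^sub>v\<^sub>u\<close>.  The locale \<open>pair_graph\<close> provides finiteness, symmetry and the
  absence of loops.  The name \<open>connected\<close> is qualified because the topological notion shares it.
\<close>

locale water_distribution_system = pair_graph G
  for G :: "'v pair_pre_digraph" +
  fixes Vr Vc :: "'v set"
    and len diam rough :: "'v \<times> 'v \<Rightarrow> real"
  assumes graph_connected: "Digraph_Component.connected (with_proj G)"
    and nodes_nonempty: "pverts G \<noteq> {}"
    and edges_nonempty: "parcs G \<noteq> {}"
    and nodes_partition: "pverts G = Vr \<union> Vc" "Vr \<inter> Vc = {}"
    and reservoirs_nonempty: "Vr \<noteq> {}"
    and consumers_nonempty: "Vc \<noteq> {}"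
    and len_pos: "\<And>e. e \<in> parcs G \<Longrightarrow> len e > 0"
    and diam_pos: "\<And>e. e \<in> parcs G \<Longrightarrow> diam e > 0"
    and rough_pos: "\<And>e. e \<in> parcs G \<Longrightarrow> rough e > 0"
    and len_sym: "\<And>v u. (v, u) \<in> parcs G \<Longrightarrow> len (v, u) = len (u, v)"
    and diam_sym: "\<And>v u. (v, u) \<in> parcs G \<Longrightarrow> diam (v, u) = diam (u, v)"
    and rough_sym: "\<And>v u. (v, u) \<in> parcs G \<Longrightarrow> rough (v, u) = rough (u, v)"

definition neighborhood :: "'v pair_pre_digraph \<Rightarrow> 'v \<Rightarrow> 'v set" where
  "neighborhood G v = {u \<in> pverts G. (v, u) \<in> parcs G \<or> (u, v) \<in> parcs G}"

definition flow_exponent :: real where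
  "flow_exponent = 1.852"

definition resistance ::
  "('v \<times> 'v \<Rightarrow> real) \<Rightarrow> ('v \<times> 'v \<Rightarrow> real) \<Rightarrow> ('v \<times> 'v \<Rightarrow> real) \<Rightarrow> 'v \<times> 'v \<Rightarrow> real" where
  "resistance len diam rough e =
     10.67 * len e * diam e powr (- 4.8704) * rough e powr (- 1.852)"

text \<open>
  A vector indexed by a finite set A is an element of \<open>A \<rightarrow>\<^sub>E UNIV\<close>: its values outside A are
  fixed to \<open>undefined\<close>, so that equality of such functions is equality on A.
\<close>

definition hydraulic_states ::
  "'v pair_pre_digraph \<Rightarrow> 'v set \<Rightarrow> (('v \<Rightarrow> real) \<times> ('v \<times> 'v \<Rightarrow> real) \<times> ('v \<Rightarrow> real)) set" where
  "hydraulic_states G Vc =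
     (pverts G \<rightarrow>\<^sub>E UNIV) \<times> (parcs G \<rightarrow>\<^sub>E UNIV) \<times> (Vc \<rightarrow>\<^sub>E UNIV)"

text \<open>
  In the first condition the case of zero flow is covered by \<open>0 powr a = 0\<close>.
\<close>

definition physically_correct ::
  "'v pair_pre_digraph \<Rightarrow> 'v set \<Rightarrow> ('v \<times> 'v \<Rightarrow> real) \<Rightarrow>
     ('v \<Rightarrow> real) \<times> ('v \<times> 'v \<Rightarrow> real) \<times> ('v \<Rightarrow> real) \<Rightarrow> bool" where
  "physically_correct G Vc r = (\<lambda>(h, q, d).
     (h, q, d) \<in> hydraulic_states G Vc \<and>
     (\<forall>v\<in>pverts G. \<forall>u\<in>neighborhood G v.
        h v - h u = r (v, u) * q (v, u) * \<bar>q (v, u)\<bar> powr (flow_exponent - 1)) \<and>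
     (\<forall>v\<in>Vc. (\<Sum>u\<in>neighborhood G v. q (v, u)) = - d v) \<and>
     (\<forall>v\<in>pverts G. \<forall>u\<in>neighborhood G v. q (u, v) = - q (v, u)))"

definition combine_heads :: "'v set \<Rightarrow> 'v set \<Rightarrow> ('v \<Rightarrow> real) \<Rightarrow> ('v \<Rightarrow> real) \<Rightarrow> 'v \<Rightarrow> real" where
  "combine_heads Vr Vc hr hc = (\<lambda>v\<in>Vr \<union> Vc. if v \<in> Vr then hr v else hc v)"

end

theory Submission
  imports Defs "HOL-Real_Asymp.Real_Asymp"
begin

text \<open>
  The head-loss law \<open>t = r * q * \<bar>q\<bar> powr (x - 1)\<close> can be solved for the flow: \<open>q\<close> is a positive constant
  \<open>k = r powr (- 1 / x)\<close> times the signed power of the head difference \<open>t\<close> with exponent \<open>a = 1/x\<close>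
  (\<open>signed_power_inverse\<close>).  Hence the heads determine the flows, these flows are automatically
  antisymmetric, and the only remaining requirement is conservation of mass at the consumers: a
  nonlinear discrete Dirichlet problem for the heads, with the reservoir heads as boundary values
  (\<open>physically_correct_iff\<close>).  It is the Euler-Lagrange equation of the convex energy
  \<open>1/2 \<Sum> k * \<bar>h v - h u\<bar> powr (1 + a) / (1 + a) - \<Sum> b v * h v\<close>, where the first sum runs over the ordered edges
  and the second one over the consumers, and where \<open>b = - d\<close> is the prescribed outflow.

  Existence is the direct method.  A node is joined by a path to some reservoir, so its head is
  bounded linearly by the largest head difference \<open>D\<close> along an edge (\<open>potential_bound\<close>); the energy
  grows like \<open>D powr (1 + a)\<close>, which beats the linear term, so its sublevel sets are bounded
  (\<open>energy_sublevel_bounded\<close>) and a minimiser exists by compactness (\<open>energy_minimizer\<close>).  The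
  derivative of the energy with respect to a single consumer head is the defect in the mass balance at that
  consumer, and it vanishes at the minimiser (\<open>balanced_exists\<close>).

  Uniqueness is monotonicity.  For two solutions \<open>h\<close> and \<open>h'\<close> with flows \<open>q\<close> and \<open>q'\<close>, summation by parts
  turns \<open>\<Sum> (q v u - q' v u) ((h - h') v - (h - h') u)\<close> into a sum over the nodes, in which every
  term vanishes: at a reservoir because the heads agree, at a consumer because the outflows agree.
  As the signed power is strictly increasing, each term over an edge is nonnegative and vanishes only
  if the head differences agree; so \<open>h - h'\<close> is constant along paths, and it is zero at the reservoirs
  (\<open>balanced_unique\<close>).
\<close>

section \<open>Signed powers\<close>

definition signed_power :: "real \<Rightarrow> real \<Rightarrow> real" where
  "signed_power a t = sgn t * \<bar>t\<bar> powr a"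

lemma signed_power_minus: "signed_power a (- t) = - signed_power a t"
  by (simp add: signed_power_def sgn_minus)

lemma strict_mono_signed_power:
  assumes "a > 0"
  shows "strict_mono (signed_power a)"
proof (rule strict_monoI)
  fix s t :: real
  assume "s < t"
  consider "0 \<le> s" | "s < 0" "0 \<le> t" | "t < 0" by linarith
  then show "signed_power a s < signed_power a t"
  proof cases
    case 1
    then have "s powr a < t powr a"
      using \<open>s < t\<close> assms by (intro powr_less_mono2) auto
    then show ?thesis
      using 1 \<open>s < t\<close> by (cases "s = 0") (auto simp: signed_power_def)
  next
    case 2
    have "signed_power a s < 0" "0 \<le> signed_power a t"
      using 2 by (auto simp: signed_power_def sgn_if)
    then show ?thesis by linarith
  next
    case 3
    then have "(- t) powr a < (- s) powr a"
      using \<open>s < t\<close> assms by (intro powr_less_mono2) auto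
    then show ?thesis
      using 3 \<open>s < t\<close> by (auto simp: signed_power_def)
  qed
qed

text \<open>
  The left-hand equation says that \<open>t / r\<close> is the signed power of \<open>q\<close> with exponent \<open>x\<close>; signed powers compose by
  multiplying their exponents, so the one with exponent \<open>1 / x\<close> inverts it.
\<close>

lemma signed_power_inverse:
  fixes r x q t :: real
  assumes "r > 0" "x > 0"
  shows "t = r * q * \<bar>q\<bar> powr (x - 1) \<longleftrightarrow> q = r powr (- 1 / x) * signed_power (1 / x) t"
proof -
  have law: "q * \<bar>q\<bar> powr (x - 1) = signed_power x q" for q
    by (cases "q = 0") (auto simp: signed_power_def powr_diff sgn_if field_simps)
  have comp: "signed_power b (signed_power c t) = signed_power (b * c) t" for b c t
    by (auto simp: signed_power_def abs_mult powr_powr mult.commute sgn_mult sgn_if)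
  have scale: "signed_power b (c * t) = c powr b * signed_power b t" if "c > 0" for b c t
    using that by (auto simp: signed_power_def abs_mult powr_mult sgn_mult)
  have one: "signed_power 1 t = t" for t
    by (auto simp: signed_power_def sgn_if)
  show ?thesis
  proof
    assume "t = r * q * \<bar>q\<bar> powr (x - 1)"
    then have "t = r * signed_power x q" using law[of q] by simp
    then have "r powr (- 1 / x) * signed_power (1 / x) t = (r powr (- 1 / x) * r powr (1 / x)) * q"
      using assms by (simp add: scale comp one)
    also have "r powr (- 1 / x) * r powr (1 / x) = 1"
      using assms by (simp flip: powr_add)
    finally show "q = r powr (- 1 / x) * signed_power (1 / x) t" by simp
  next
    assume q: "q = r powr (- 1 / x) * signed_power (1 / x) t"
    have "signed_power x q = (r powr (- 1 / x)) powr x * signed_power x (signed_power (1 / x) t)"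
      unfolding q using assms by (intro scale) simp
    also have "(r powr (- 1 / x)) powr x = 1 / r"
      using assms by (subst powr_powr) (simp add: powr_minus_divide)
    also have "signed_power x (signed_power (1 / x) t) = t"
      using assms by (simp add: comp one)
    finally have "r * signed_power x q = t" using assms by simp
    then have "r * q * \<bar>q\<bar> powr (x - 1) = t"
      using law[of q] by (simp add: mult.assoc)
    then show "t = r * q * \<bar>q\<bar> powr (x - 1)" by simp
  qed
qed

text \<open>
  Away from zero this is the chain rule.  At zero, where \<open>abs\<close> is not differentiable, the difference
  quotient is itself a signed power with a positive exponent, hence tends to zero.
\<close>

lemma has_real_derivative_abs_powr:
  fixes a t :: real
  assumes "a > 0"
  shows "((\<lambda>t. \<bar>t\<bar> powr (1 + a)) has_real_derivative (1 + a) * signed_power a t) (at t)"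
proof (cases "t = 0")
  case True
  have "((\<lambda>t::real. \<bar>t\<bar> powr a) \<longlongrightarrow> 0) (at 0)"
    using assms by real_asymp
  then have "((\<lambda>t::real. sgn t * \<bar>t\<bar> powr a) \<longlongrightarrow> 0) (at 0)"
    by (rule tendsto_rabs_zero_cancel[OF Lim_transform_eventually])
       (auto simp: eventually_at_filter abs_mult sgn_if)
  then have "((\<lambda>h::real. (\<bar>0 + h\<bar> powr (1 + a) - \<bar>0::real\<bar> powr (1 + a)) / h) \<longlongrightarrow> 0) (at 0)"
    by (rule Lim_transform_eventually)
       (auto simp: eventually_at_filter powr_add sgn_if field_simps)
  then show ?thesis
    using True by (simp add: DERIV_def signed_power_def)
next
  case False
  have "(abs has_real_derivative sgn t) (at t)"
  proof (cases "t > 0")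
    case True
    show ?thesis
      by (rule has_field_derivative_transform_within_open[of "\<lambda>x. x" _ _ "{0<..}"])
        (use True in \<open>auto intro!: derivative_eq_intros\<close>)
  next
    case nonpos: False
    show ?thesis
      by (rule has_field_derivative_transform_within_open[of "\<lambda>x. - x" _ _ "{..<0}"])
        (use nonpos False in \<open>auto intro!: derivative_eq_intros\<close>)
  qed
  then show ?thesis
    using False by (auto intro!: derivative_eq_intros simp: signed_power_def)
qed

section \<open>Potentials on a network with power-law conductances\<close>

text \<open>
  The discrete divergence theorem, which serves twice: for uniqueness \<open>\<eta>\<close> is the difference of two
  solutions, for existence it is a variation of the potential.  The factor 2 arises because every
  undirected edge is counted in both directions.
\<close>

lemma summation_by_parts:
  fixes q :: "'v \<times> 'v \<Rightarrow> real" and \<eta> :: "'v \<Rightarrow> real"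
  assumes "finite V" "E \<subseteq> V \<times> V" "sym E"
    and antisym: "\<And>v u. (v, u) \<in> E \<Longrightarrow> q (u, v) = - q (v, u)"
  shows "(\<Sum>(v, u)\<in>E. q (v, u) * (\<eta> v - \<eta> u)) = 2 * (\<Sum>v\<in>V. \<eta> v * (\<Sum>u\<in>E `` {v}. q (v, u)))"
proof -
  have E: "E = Sigma V (\<lambda>v. E `` {v})" using assms(2) by auto
  have fin: "finite E" using assms(1,2) by (meson finite_SigmaI finite_subset)
  have "(\<Sum>(v, u)\<in>E. q (v, u) * \<eta> u) = (\<Sum>(v, u)\<in>E. q (u, v) * \<eta> v)"
    using \<open>sym E\<close> by (intro sum.reindex_bij_witness[where i = prod.swap and j = prod.swap]) (auto dest: symD)
  also have "\<dots> = (\<Sum>(v, u)\<in>E. - (q (v, u) * \<eta> v))"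
    by (rule sum.cong) (auto simp: antisym)
  also have "\<dots> = - (\<Sum>(v, u)\<in>E. q (v, u) * \<eta> v)"
    by (simp add: sum_negf case_prod_unfold)
  finally have "(\<Sum>(v, u)\<in>E. q (v, u) * (\<eta> v - \<eta> u)) = 2 * (\<Sum>(v, u)\<in>E. q (v, u) * \<eta> v)"
    by (simp add: case_prod_unfold right_diff_distrib sum_subtractf)
  also have "(\<Sum>(v, u)\<in>E. q (v, u) * \<eta> v) = (\<Sum>v\<in>V. \<Sum>u\<in>E `` {v}. q (v, u) * \<eta> v)"
    using E fin assms(1) by (subst E, subst sum.Sigma[symmetric]) auto
  also have "\<dots> = (\<Sum>v\<in>V. \<eta> v * (\<Sum>u\<in>E `` {v}. q (v, u)))"
    by (simp add: sum_distrib_left mult.commute)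
  finally show ?thesis .
qed

text \<open>
  The nodes in \<open>S\<close> are those with prescribed potential (the reservoirs); every node must reach one of them,
  since otherwise the potential of its component would be determined only up to a constant.
\<close>

locale resistor_network =
  fixes V S :: "'v set" and E :: "('v \<times> 'v) set" and k :: "'v \<times> 'v \<Rightarrow> real" and a :: real
  assumes finite_nodes: "finite V"
    and edges_subset: "E \<subseteq> V \<times> V"
    and edges_sym: "sym E"
    and grounded_subset: "S \<subseteq> V"
    and grounded_reachable: "\<And>v. v \<in> V \<Longrightarrow> \<exists>s\<in>S. (v, s) \<in> E\<^sup>*"
    and conductance_pos: "\<And>e. e \<in> E \<Longrightarrow> k e > 0"
    and conductance_sym: "\<And>v u. (v, u) \<in> E \<Longrightarrow> k (u, v) = k (v, u)"
    and exponent_pos: "a > 0"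
begin

definition flow :: "('v \<Rightarrow> real) \<Rightarrow> 'v \<times> 'v \<Rightarrow> real" where
  "flow h = (\<lambda>(v, u). k (v, u) * signed_power a (h v - h u))"

text \<open>
  Here \<open>b\<close> is the net outflow from a node into the network, the negative of a demand.
\<close>

definition balanced :: "('v \<Rightarrow> real) \<Rightarrow> ('v \<Rightarrow> real) \<Rightarrow> bool" where
  "balanced b h \<longleftrightarrow> (\<forall>v\<in>V - S. (\<Sum>u\<in>E `` {v}. flow h (v, u)) = b v)"

text \<open>
  The normalisation makes the derivative of the first term, in the direction of the indicator
  of a node, the outflow at that node: one factor 2 undoes the double counting of the edges, and
  \<open>1 + a\<close> cancels the exponent that differentiation produces.
\<close>

definition energy :: "('v \<Rightarrow> real) \<Rightarrow> ('v \<Rightarrow> real) \<Rightarrow> real" where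
  "energy b h = (\<Sum>(v, u)\<in>E. k (v, u) * \<bar>h v - h u\<bar> powr (1 + a)) / (2 * (1 + a)) -
     (\<Sum>v\<in>V - S. b v * h v)"

lemma finite_edges: "finite E"
  using finite_nodes edges_subset by (meson finite_SigmaI finite_subset)

lemma flow_antisym: "(v, u) \<in> E \<Longrightarrow> flow h (u, v) = - flow h (v, u)"
  using conductance_sym[of v u] signed_power_minus[of a "h v - h u"] by (simp add: flow_def)

text \<open>
  The product has the form \<open>(\<phi> s - \<phi> t) * (s - t)\<close> for a strictly increasing function \<open>\<phi>\<close>, where \<open>s\<close>
  and \<open>t\<close> are the potential differences along the edge.
\<close>

lemma flow_monotone:
  assumes "(v, u) \<in> E"
  shows "0 \<le> (flow h (v, u) - flow h' (v, u)) * ((h v - h' v) - (h u - h' u))"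
    and "(flow h (v, u) - flow h' (v, u)) * ((h v - h' v) - (h u - h' u)) = 0 \<longleftrightarrow>
      h v - h u = h' v - h' u"
proof -
  define s t where "s = h v - h u" and "t = h' v - h' u"
  have eq: "(flow h (v, u) - flow h' (v, u)) * ((h v - h' v) - (h u - h' u)) =
      k (v, u) * ((signed_power a s - signed_power a t) * (s - t))"
    by (simp add: flow_def s_def t_def algebra_simps)
  have "k (v, u) > 0" using assms by (rule conductance_pos)
  moreover have "(signed_power a s - signed_power a t) * (s - t) > 0" if "s \<noteq> t"
    using that strict_mono_signed_power[OF exponent_pos]
    by (auto simp: strict_mono_less zero_less_mult_iff)
  ultimately have "k (v, u) * ((signed_power a s - signed_power a t) * (s - t)) > 0" if "s \<noteq> t"
    using that by simp
  then show "0 \<le> (flow h (v, u) - flow h' (v, u)) * ((h v - h' v) - (h u - h' u))"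
    and "(flow h (v, u) - flow h' (v, u)) * ((h v - h' v) - (h u - h' u)) = 0 \<longleftrightarrow>
      h v - h u = h' v - h' u"
    unfolding eq s_def[symmetric] t_def[symmetric] by (cases "s = t"; fastforce)+
qed

text \<open>
  Applied to the difference of the two flows and the difference of the two potentials, summation by
  parts yields zero, because at every node one of the two differences (potential or total outflow)
  vanishes.  Monotonicity then forces the potential differences to agree on each edge.
\<close>

lemma balanced_unique:
  assumes "balanced b h" "balanced b h'"
    and grounded: "\<And>s. s \<in> S \<Longrightarrow> h s = h' s"
    and "v \<in> V"
  shows "h v = h' v"
proof -
  define \<eta> where "\<eta> v = h v - h' v" for v
  define q where "q e = flow h e - flow h' e" for e
  have "(\<Sum>(v, u)\<in>E. q (v, u) * (\<eta> v - \<eta> u)) = 2 * (\<Sum>v\<in>V. \<eta> v * (\<Sum>u\<in>E `` {v}. q (v, u)))"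
    using finite_nodes edges_subset edges_sym
    by (rule summation_by_parts) (simp add: q_def flow_antisym)
  also have "\<eta> v * (\<Sum>u\<in>E `` {v}. q (v, u)) = 0" if "v \<in> V" for v
    using that assms(1,2) grounded
    by (cases "v \<in> S") (auto simp: balanced_def q_def \<eta>_def sum_subtractf)
  then have "2 * (\<Sum>v\<in>V. \<eta> v * (\<Sum>u\<in>E `` {v}. q (v, u))) = 0"
    by (simp add: sum.neutral del: mult_eq_0_iff)
  finally have "(\<Sum>(v, u)\<in>E. q (v, u) * (\<eta> v - \<eta> u)) = 0" .
  then have "\<forall>e\<in>E. (case e of (v, u) \<Rightarrow> q (v, u) * (\<eta> v - \<eta> u)) = 0"
    using flow_monotone(1) by (subst (asm) sum_nonneg_eq_0_iff) (auto simp: finite_edges q_def \<eta>_def)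
  then have edge: "h v - h u = h' v - h' u" if "(v, u) \<in> E" for v u
    using that flow_monotone(2) by (fastforce simp: q_def \<eta>_def)
  obtain s where "s \<in> S" "(v, s) \<in> E\<^sup>*" using grounded_reachable \<open>v \<in> V\<close> by blast
  from this(2) show ?thesis
  proof (induction rule: converse_rtrancl_induct)
    case base
    then show ?case using grounded \<open>s \<in> S\<close> by simp
  next
    case (step v u)
    then show ?case using edge[of v u] by simp
  qed
qed

text \<open>
  Along a walk of \<open>n\<close> edges the potential changes by at most \<open>n * D\<close>.  What matters is that \<open>N\<close> does not
  depend on \<open>h\<close>; it is the sum over the nodes of the length of some walk into \<open>S\<close>.
\<close>

lemma potential_bound:
  obtains N :: real where "N \<ge> 0"
    and "\<And>h D v. D \<ge> 0 \<Longrightarrow> (\<And>v u. (v, u) \<in> E \<Longrightarrow> \<bar>h v - h u\<bar> \<le> D) \<Longrightarrow> v \<in> V \<Longrightarrow>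
      \<bar>h v\<bar> \<le> (\<Sum>s\<in>S. \<bar>h s\<bar>) + N * D"
proof -
  have "\<exists>n s. s \<in> S \<and> (v, s) \<in> E ^^ n" if "v \<in> V" for v
    using grounded_reachable[OF that] rtrancl_imp_relpow by blast
  then obtain n s where ns: "\<And>v. v \<in> V \<Longrightarrow> s v \<in> S \<and> (v, s v) \<in> E ^^ n v" by metis
  have walk: "\<bar>h v - h w\<bar> \<le> real m * D"
    if "\<And>v u. (v, u) \<in> E \<Longrightarrow> \<bar>h v - h u\<bar> \<le> D" "(v, w) \<in> E ^^ m" for h :: "'v \<Rightarrow> real" and D v w m
    using that(2)
  proof (induction m arbitrary: w)
    case (Suc m)
    then obtain u where "(v, u) \<in> E ^^ m" "(u, w) \<in> E" by auto
    then have "\<bar>h v - h u\<bar> \<le> real m * D" "\<bar>h u - h w\<bar> \<le> D" using Suc.IH that(1) by auto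
    then show ?case by (simp add: algebra_simps)
  qed simp
  show ?thesis
  proof (rule that[of "\<Sum>v\<in>V. real (n v)"])
    fix h :: "'v \<Rightarrow> real" and D v
    assume D: "D \<ge> 0" and h: "\<And>v u. (v, u) \<in> E \<Longrightarrow> \<bar>h v - h u\<bar> \<le> D" and v: "v \<in> V"
    have "\<bar>h v - h (s v)\<bar> \<le> real (n v) * D" using walk[of h D v "s v" "n v"] h ns[OF v] by blast
    also have "\<dots> \<le> (\<Sum>v\<in>V. real (n v)) * D"
      using finite_nodes v D by (intro mult_right_mono member_le_sum) auto
    finally have "\<bar>h v - h (s v)\<bar> \<le> (\<Sum>v\<in>V. real (n v)) * D" .
    moreover have "\<bar>h (s v)\<bar> \<le> (\<Sum>s\<in>S. \<bar>h s\<bar>)"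
      using ns[OF v] finite_subset[OF grounded_subset finite_nodes] by (intro member_le_sum) auto
    ultimately show "\<bar>h v\<bar> \<le> (\<Sum>s\<in>S. \<bar>h s\<bar>) + (\<Sum>v\<in>V. real (n v)) * D" by linarith
  qed (simp add: sum_nonneg)
qed

text \<open>
  Coercivity.  With \<open>D\<close> the largest potential difference along an edge, that edge alone contributes at least
  \<open>\<kappa> * D powr (1 + a)\<close> to the energy, whereas the linear term is at most \<open>B * (R + N * D)\<close> by the
  previous lemma.  So an energy bound bounds \<open>D\<close>, and thereby all potentials.
\<close>

lemma energy_sublevel_bounded:
  obtains M :: real where "M \<ge> 0"
    and "\<And>h v. (\<And>s. s \<in> S \<Longrightarrow> h s = f s) \<Longrightarrow> energy b h \<le> C \<Longrightarrow> v \<in> V \<Longrightarrow> \<bar>h v\<bar> \<le> M"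
proof -
  obtain N :: real where N: "N \<ge> 0" "\<And>h D v. D \<ge> 0 \<Longrightarrow> (\<And>v u. (v, u) \<in> E \<Longrightarrow> \<bar>h v - h u\<bar> \<le> D) \<Longrightarrow> v \<in> V \<Longrightarrow>
      \<bar>h v\<bar> \<le> (\<Sum>s\<in>S. \<bar>h s\<bar>) + N * D"
    using potential_bound by blast
  define R where "R = (\<Sum>s\<in>S. \<bar>f s\<bar>)"
  define B where "B = (\<Sum>v\<in>V - S. \<bar>b v\<bar>)"
  define \<kappa> where "\<kappa> = Min (insert 1 (k ` E)) / (2 * (1 + a))"
  have "R \<ge> 0" "B \<ge> 0" by (simp_all add: R_def B_def sum_nonneg)
  have "\<kappa> > 0"
    using finite_edges conductance_pos exponent_pos by (auto simp: \<kappa>_def)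
  have "filterlim (\<lambda>D. \<kappa> * D powr (1 + a) - B * (R + N * D)) at_top at_top"
    using \<open>\<kappa> > 0\<close> exponent_pos by real_asymp
  then have "eventually (\<lambda>D. C < \<kappa> * D powr (1 + a) - B * (R + N * D)) at_top"
    by (simp add: filterlim_at_top_dense)
  then obtain D0 where D0: "\<And>D. D \<ge> D0 \<Longrightarrow> C < \<kappa> * D powr (1 + a) - B * (R + N * D)"
    by (auto simp: eventually_at_top_linorder)
  show ?thesis
  proof (rule that[of "R + N * \<bar>D0\<bar>"])
    fix h v
    assume hf: "\<And>s. s \<in> S \<Longrightarrow> h s = f s" and C: "energy b h \<le> C" and v: "v \<in> V"
    \<comment> \<open>The element 0 makes the maximum meaningful if there are no edges; likewise the element 1
      in the minimum that defines \<open>\<kappa>\<close>.\<close>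
    define D where "D = Max (insert 0 ((\<lambda>(v, u). \<bar>h v - h u\<bar>) ` E))"
    have fin: "finite (insert 0 ((\<lambda>(v, u). \<bar>h v - h u\<bar>) ` E))" using finite_edges by simp
    have "D \<ge> 0" unfolding D_def using fin by simp
    have "\<bar>h v - h u\<bar> \<le> D" if "(v, u) \<in> E" for v u
      unfolding D_def using that fin by (intro Max_ge) force+
    moreover have "(\<Sum>s\<in>S. \<bar>h s\<bar>) = R" by (simp add: R_def hf)
    ultimately have bound: "\<bar>h v\<bar> \<le> R + N * D" if "v \<in> V" for v
      using N(2)[OF \<open>D \<ge> 0\<close>, of h] that by metis
    have "\<kappa> * D powr (1 + a) \<le> (\<Sum>(v, u)\<in>E. k (v, u) * \<bar>h v - h u\<bar> powr (1 + a)) / (2 * (1 + a))"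
    proof (cases "D = 0")
      case True
      have "0 \<le> (\<Sum>(v, u)\<in>E. k (v, u) * \<bar>h v - h u\<bar> powr (1 + a))"
        by (rule sum_nonneg) (use conductance_pos in \<open>force intro: less_imp_le\<close>)
      then show ?thesis using True exponent_pos by simp
    next
      case False
      then obtain w u where wu: "(w, u) \<in> E" "D = \<bar>h w - h u\<bar>"
        using Max_in[OF fin] unfolding D_def by auto
      have "Min (insert 1 (k ` E)) * D powr (1 + a) \<le> k (w, u) * D powr (1 + a)"
        using wu(1) finite_edges by (intro mult_right_mono Min_le) auto
      also have "\<dots> = (case (w, u) of (v, u) \<Rightarrow> k (v, u) * \<bar>h v - h u\<bar> powr (1 + a))"
        by (simp add: wu(2))
      also have "\<dots> \<le> (\<Sum>(v, u)\<in>E. k (v, u) * \<bar>h v - h u\<bar> powr (1 + a))"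
        using wu(1) finite_edges
        by (intro member_le_sum) (use conductance_pos in \<open>force intro: less_imp_le\<close>)+
      finally show ?thesis
        using exponent_pos by (simp add: \<kappa>_def divide_right_mono)
    qed
    moreover have "(\<Sum>v\<in>V - S. b v * h v) \<le> B * (R + N * D)"
      unfolding B_def sum_distrib_right
    proof (rule sum_mono)
      fix v assume "v \<in> V - S"
      then have "\<bar>b v\<bar> * \<bar>h v\<bar> \<le> \<bar>b v\<bar> * (R + N * D)"
        using bound by (intro mult_left_mono) auto
      then show "b v * h v \<le> \<bar>b v\<bar> * (R + N * D)"
        using abs_ge_self[of "b v * h v"] by (simp add: abs_mult)
    qed
    ultimately have "\<kappa> * D powr (1 + a) - B * (R + N * D) \<le> C"
      using C by (simp add: energy_def)
    then have "D < D0" using D0[of D] by linarith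
    then have "N * D \<le> N * \<bar>D0\<bar>" using N(1) by (intro mult_left_mono) auto
    then show "\<bar>h v\<bar> \<le> R + N * \<bar>D0\<bar>" using bound[OF v] by linarith
  qed (use \<open>R \<ge> 0\<close> N(1) in simp)
qed

lemma energy_cong: "(\<And>v. v \<in> V \<Longrightarrow> h v = h' v) \<Longrightarrow> energy b h = energy b h'"
proof -
  assume eq: "\<And>v. v \<in> V \<Longrightarrow> h v = h' v"
  have "(\<Sum>(v, u)\<in>E. k (v, u) * \<bar>h v - h u\<bar> powr (1 + a)) =
      (\<Sum>(v, u)\<in>E. k (v, u) * \<bar>h' v - h' u\<bar> powr (1 + a))"
    using edges_subset eq by (intro sum.cong) auto
  then show ?thesis by (simp add: energy_def eq)
qed

lemma continuous_on_energy: "continuous_on K (energy b)"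
proof -
  have coord: "continuous_on K (\<lambda>h. h v)" for v :: 'v
    by (rule continuous_on_subset[OF continuous_on_product_coordinates subset_UNIV])
  show ?thesis
    unfolding energy_def case_prod_unfold
    using exponent_pos by (intro continuous_intros coord continuous_on_powr') auto
qed

text \<open>
  The sublevel set of a reference potential \<open>h0\<close> lies in a box, which is compact by Tychonoff's theorem.
  Outside \<open>V\<close> the box has a single point per coordinate, so that it is compact also in an infinite
  type of nodes and its elements are extensional functions on \<open>V\<close>.
\<close>

lemma energy_minimizer:
  obtains h where "h \<in> V \<rightarrow>\<^sub>E UNIV" "\<And>s. s \<in> S \<Longrightarrow> h s = f s"
    and "\<And>h'. (\<And>s. s \<in> S \<Longrightarrow> h' s = f s) \<Longrightarrow> energy b h \<le> energy b h'"
proof -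
  define h0 where "h0 = (\<lambda>v\<in>V. if v \<in> S then f v else 0)"
  obtain M :: real where M: "M \<ge> 0" "\<And>h v. (\<And>s. s \<in> S \<Longrightarrow> h s = f s) \<Longrightarrow> energy b h \<le> energy b h0 \<Longrightarrow>
      v \<in> V \<Longrightarrow> \<bar>h v\<bar> \<le> M"
    using energy_sublevel_bounded by blast
  define B where "B v = (if v \<in> S then {f v} else if v \<in> V then {- M..M} else {undefined})" for v
  define K where "K = Pi\<^sub>E UNIV B"
  have "compactin (product_topology (\<lambda>_. euclidean) UNIV) K"
    unfolding K_def by (subst compactin_PiE) (simp add: B_def)
  then have "compact K" by (simp add: euclidean_product_topology)
  moreover have "h0 \<in> K"
    using M(1) grounded_subset by (auto simp: K_def B_def h0_def)
  ultimately obtain h where h: "h \<in> K" "\<And>h'. h' \<in> K \<Longrightarrow> energy b h \<le> energy b h'"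
    using continuous_attains_inf[OF _ _ continuous_on_energy] by (metis empty_iff)
  show ?thesis
  proof (rule that[of h])
    have hB: "h v \<in> B v" for v using h(1) by (auto simp: K_def)
    show "h \<in> V \<rightarrow>\<^sub>E UNIV"
      using hB grounded_subset by (fastforce simp: B_def PiE_def extensional_def split: if_splits)
    show "h s = f s" if "s \<in> S" for s
      using hB[of s] that by (simp add: B_def)
  next
    fix h' assume h': "\<And>s. s \<in> S \<Longrightarrow> h' s = f s"
    show "energy b h \<le> energy b h'"
    proof (cases "energy b h' \<le> energy b h0")
      case True
      then have "restrict h' V \<in> K"
        using M(2)[of h'] h' grounded_subset by (auto simp: K_def B_def abs_le_iff minus_le_iff)
      then have "energy b h \<le> energy b (restrict h' V)" by (rule h(2))
      also have "\<dots> = energy b h'" by (rule energy_cong) simp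
      finally show ?thesis .
    next
      case False
      then show ?thesis using h(2)[OF \<open>h0 \<in> K\<close>] by linarith
    qed
  qed
qed

text \<open>
  Variations vanish on \<open>S\<close>, so as to keep the prescribed values.  Termwise differentiation gives
  \<open>1/2 \<Sum> flow h (v, u) * (\<eta> v - \<eta> u) - \<Sum> b v * \<eta> v\<close>, and summation by parts collects the coefficient of each \<open>\<eta> v\<close>.
\<close>

lemma energy_directional_derivative:
  assumes "\<And>s. s \<in> S \<Longrightarrow> \<eta> s = 0"
  shows "((\<lambda>t. energy b (\<lambda>v. h v + t * \<eta> v)) has_real_derivative
    (\<Sum>v\<in>V - S. \<eta> v * ((\<Sum>u\<in>E `` {v}. flow h (v, u)) - b v))) (at 0)"
proof -
  have "((\<lambda>t. \<bar>(h v + t * \<eta> v) - (h u + t * \<eta> u)\<bar> powr (1 + a)) has_real_derivative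
      (1 + a) * signed_power a (h v - h u) * (\<eta> v - \<eta> u)) (at 0)" for v u
    by (rule DERIV_chain2[OF has_real_derivative_abs_powr[OF exponent_pos], THEN DERIV_cong])
       (auto intro!: derivative_eq_intros)
  note [derivative_intros] = this
  have "((\<lambda>t. energy b (\<lambda>v. h v + t * \<eta> v)) has_real_derivative
      (\<Sum>(v, u)\<in>E. k (v, u) * ((1 + a) * signed_power a (h v - h u) * (\<eta> v - \<eta> u))) / (2 * (1 + a)) -
      (\<Sum>v\<in>V - S. b v * \<eta> v)) (at 0)"
    unfolding energy_def case_prod_unfold
    using exponent_pos by (auto intro!: derivative_eq_intros simp: mult.commute mult.left_commute)
  also have "(\<Sum>(v, u)\<in>E. k (v, u) * ((1 + a) * signed_power a (h v - h u) * (\<eta> v - \<eta> u))) / (2 * (1 + a)) =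
      (\<Sum>(v, u)\<in>E. flow h (v, u) * (\<eta> v - \<eta> u)) / 2"
    unfolding sum_divide_distrib case_prod_unfold flow_def
  proof (rule sum.cong)
    have "x * ((1 + a) * y * z) / (2 * (1 + a)) = x * y * z / 2" for x y z :: real
      using exponent_pos by (simp add: field_simps)
    then show "k (fst e, snd e) * ((1 + a) * signed_power a (h (fst e) - h (snd e)) * (\<eta> (fst e) - \<eta> (snd e))) /
        (2 * (1 + a)) =
      k (fst (fst e, snd e), snd (fst e, snd e)) *
        signed_power a (h (fst (fst e, snd e)) - h (snd (fst e, snd e))) * (\<eta> (fst e) - \<eta> (snd e)) / 2" for e
      by simp
  qed simp
  also have "\<dots> = (\<Sum>v\<in>V. \<eta> v * (\<Sum>u\<in>E `` {v}. flow h (v, u)))"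
    using summation_by_parts[OF finite_nodes edges_subset edges_sym, of "flow h" \<eta>] flow_antisym
    by simp
  also have "\<dots> = (\<Sum>v\<in>V - S. \<eta> v * (\<Sum>u\<in>E `` {v}. flow h (v, u)))"
    using finite_nodes assms by (intro sum.mono_neutral_right) auto
  finally show ?thesis
    by (simp add: right_diff_distrib sum_subtractf mult.commute)
qed

text \<open>
  Varying a minimiser at one free node \<open>v\<close> only, i.e. along the indicator of \<open>v\<close>, isolates the balance equation at \<open>v\<close>.
\<close>

lemma balanced_exists:
  obtains h where "h \<in> V \<rightarrow>\<^sub>E UNIV" "\<And>s. s \<in> S \<Longrightarrow> h s = f s" "balanced b h"
proof -
  obtain h where h: "h \<in> V \<rightarrow>\<^sub>E UNIV" "\<And>s. s \<in> S \<Longrightarrow> h s = f s"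
    and min: "\<And>h'. (\<And>s. s \<in> S \<Longrightarrow> h' s = f s) \<Longrightarrow> energy b h \<le> energy b h'"
    using energy_minimizer by blast
  have "(\<Sum>u\<in>E `` {v}. flow h (v, u)) = b v" if v: "v \<in> V - S" for v
  proof -
    define \<eta> :: "'v \<Rightarrow> real" where "\<eta> = indicator {v}"
    have \<eta>: "\<eta> s = 0" if "s \<in> S" for s using that v by (auto simp: \<eta>_def indicator_def)
    have "(\<Sum>w\<in>V - S. \<eta> w * ((\<Sum>u\<in>E `` {w}. flow h (w, u)) - b w)) = 0"
      by (rule DERIV_local_min[OF energy_directional_derivative[OF \<eta>] zero_less_one])
         (use \<eta> h(2) in \<open>auto intro!: min\<close>)
    also have "(\<Sum>w\<in>V - S. \<eta> w * ((\<Sum>u\<in>E `` {w}. flow h (w, u)) - b w)) =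
        (\<Sum>w\<in>{v}. \<eta> w * ((\<Sum>u\<in>E `` {w}. flow h (w, u)) - b w))"
      using v finite_nodes by (intro sum.mono_neutral_right) (auto simp: \<eta>_def)
    finally show ?thesis by (simp add: \<eta>_def)
  qed
  then have "balanced b h" by (simp add: balanced_def)
  with h show ?thesis by (rule that)
qed

end

section \<open>Water distribution systems as resistor networks\<close>

context water_distribution_system
begin

abbreviation resist :: "'v \<times> 'v \<Rightarrow> real" where
  "resist \<equiv> resistance len diam rough"

definition conductance :: "'v \<times> 'v \<Rightarrow> real" where
  "conductance e = resist e powr (- 1 / flow_exponent)"

lemma resistance_pos: "e \<in> parcs G \<Longrightarrow> resist e > 0"
  using len_pos[of e] diam_pos[of e] rough_pos[of e] by (simp add: resistance_def)

lemma resistance_sym: "(v, u) \<in> parcs G \<Longrightarrow> resist (u, v) = resist (v, u)"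
  by (simp add: resistance_def len_sym[of v u] diam_sym[of v u] rough_sym[of v u])

lemma parcs_sym: "sym (parcs G)"
  using pair_sym_arcs by (simp add: symmetric_def)

lemma parcs_subset: "parcs G \<subseteq> pverts G \<times> pverts G"
  using in_arcsD1 in_arcsD2 by auto

lemma neighborhood_eq: "neighborhood G v = parcs G `` {v}"
  using parcs_sym parcs_subset by (auto simp: neighborhood_def dest: symD)

sublocale resistor_network "pverts G" Vr "parcs G" conductance "1 / flow_exponent"
proof
  show "\<exists>s\<in>Vr. (v, s) \<in> (parcs G)\<^sup>*" if "v \<in> pverts G" for v
  proof -
    obtain s where s: "s \<in> Vr" using reservoirs_nonempty by blast
    have "strongly_connected (with_proj G)"
      using symmetric_connected_imp_strongly_connected pair_sym_arcs graph_connected by blast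
    then have "v \<rightarrow>\<^sup>*\<^bsub>with_proj G\<^esub> s"
      using that s nodes_partition(1) by (auto simp: strongly_connected_def)
    then show ?thesis using s by (auto simp: reachable_conv)
  qed
  show "conductance e > 0" if "e \<in> parcs G" for e
    using resistance_pos[OF that] by (simp add: conductance_def)
qed (use pair_finite_verts parcs_sym parcs_subset nodes_partition(1) in
      \<open>auto simp: conductance_def resistance_sym flow_exponent_def\<close>)

text \<open>
  Conservation of energy pins down every flow by the head difference, conservation of mass is then the
  balance equation, and conservation of flows follows because the signed power is odd and the
  resistance symmetric.
\<close>

lemma physically_correct_iff:
  assumes "h \<in> pverts G \<rightarrow>\<^sub>E UNIV" "q \<in> parcs G \<rightarrow>\<^sub>E UNIV" "d \<in> Vc \<rightarrow>\<^sub>E UNIV"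
  shows "physically_correct G Vc resist (h, q, d) \<longleftrightarrow>
    q = restrict (flow h) (parcs G) \<and> balanced (\<lambda>v. - d v) h"
proof -
  have Vc: "Vc = pverts G - Vr" using nodes_partition by auto
  have law: "h v - h u = resist (v, u) * q (v, u) * \<bar>q (v, u)\<bar> powr (flow_exponent - 1) \<longleftrightarrow>
      q (v, u) = flow h (v, u)" if "(v, u) \<in> parcs G" for v u
  proof -
    have "flow h (v, u) = resist (v, u) powr (- 1 / flow_exponent) * signed_power (1 / flow_exponent) (h v - h u)"
      by (simp only: flow_def prod.case conductance_def)
    moreover have "flow_exponent > 0" by (simp add: flow_exponent_def)
    ultimately show ?thesis
      using signed_power_inverse[OF resistance_pos[OF that]] by metis
  qed
  have "(\<forall>v\<in>pverts G. \<forall>u\<in>neighborhood G v.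
        h v - h u = resist (v, u) * q (v, u) * \<bar>q (v, u)\<bar> powr (flow_exponent - 1)) \<longleftrightarrow>
      (\<forall>e\<in>parcs G. q e = flow h e)"
    using law parcs_subset by (auto simp: neighborhood_eq)
  also have "\<dots> \<longleftrightarrow> q = restrict (flow h) (parcs G)"
    using assms(2) by (auto simp: fun_eq_iff PiE_def extensional_def)
  finally have energy_law: "(\<forall>v\<in>pverts G. \<forall>u\<in>neighborhood G v.
        h v - h u = resist (v, u) * q (v, u) * \<bar>q (v, u)\<bar> powr (flow_exponent - 1)) \<longleftrightarrow>
      q = restrict (flow h) (parcs G)" .
  have mass: "(\<forall>v\<in>Vc. (\<Sum>u\<in>neighborhood G v. q (v, u)) = - d v) \<longleftrightarrow> balanced (\<lambda>v. - d v) h"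
    if "q = restrict (flow h) (parcs G)"
    by (simp add: that balanced_def Vc neighborhood_eq)
  have flows: "\<forall>v\<in>pverts G. \<forall>u\<in>neighborhood G v. q (u, v) = - q (v, u)"
    if "q = restrict (flow h) (parcs G)"
  proof (intro ballI)
    fix v u
    assume "u \<in> neighborhood G v"
    then have vu: "(v, u) \<in> parcs G" by (simp add: neighborhood_eq)
    then have "(u, v) \<in> parcs G" using parcs_sym by (rule symD[rotated])
    then show "q (u, v) = - q (v, u)" using vu flow_antisym[OF vu, of h] by (simp add: that)
  qed
  show ?thesis
    unfolding physically_correct_def hydraulic_states_def
    using assms energy_law mass flows by auto
qed

end

theorem theorem3p28:
  fixes G :: "'v pair_pre_digraph"
    and Vr Vc :: "'v set"
    and len diam rough :: "'v \<times> 'v \<Rightarrow> real"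
    and hr d :: "'v \<Rightarrow> real"
  assumes "water_distribution_system G Vr Vc len diam rough"
    and "hr \<in> Vr \<rightarrow>\<^sub>E UNIV"
    and "d \<in> Vc \<rightarrow>\<^sub>E UNIV"
  shows "\<exists>!(hc, q) \<in> (Vc \<rightarrow>\<^sub>E UNIV) \<times> (parcs G \<rightarrow>\<^sub>E UNIV).
           physically_correct G Vc (resistance len diam rough)
             (combine_heads Vr Vc hr hc, q, d)"
proof -
  interpret water_distribution_system G Vr Vc len diam rough by fact
  define full where "full = combine_heads Vr Vc hr"
  have full: "full hc \<in> pverts G \<rightarrow>\<^sub>E UNIV" for hc
    using nodes_partition(1) by (auto simp: full_def combine_heads_def)
  have full_Vr: "full hc v = hr v" if "v \<in> Vr" for hc v
    using that by (simp add: full_def combine_heads_def)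
  have full_Vc: "full hc v = hc v" if "v \<in> Vc" for hc v
    using that nodes_partition(2) by (auto simp: full_def combine_heads_def)
  have correct: "physically_correct G Vc resist (full hc, q, d) \<longleftrightarrow>
      q = restrict (flow (full hc)) (parcs G) \<and> balanced (\<lambda>v. - d v) (full hc)"
    if "q \<in> parcs G \<rightarrow>\<^sub>E UNIV" for hc q
    using full that assms(3) by (rule physically_correct_iff)
  obtain h where h: "h \<in> pverts G \<rightarrow>\<^sub>E UNIV" "\<And>s. s \<in> Vr \<Longrightarrow> h s = hr s" "balanced (\<lambda>v. - d v) h"
    using balanced_exists by blast
  define hc where "hc = restrict h Vc"
  have full_hc: "full hc = h"
    using h(1,2) nodes_partition
    by (auto simp: full_def combine_heads_def hc_def fun_eq_iff PiE_def extensional_def)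
  have unique: "hc' = hc" if "hc' \<in> Vc \<rightarrow>\<^sub>E UNIV" "balanced (\<lambda>v. - d v) (full hc')" for hc'
  proof
    fix v
    show "hc' v = hc v"
    proof (cases "v \<in> Vc")
      case True
      have "full hc' v = full hc v"
        by (rule balanced_unique[OF that(2)])
           (use h(3) True nodes_partition(1) in \<open>auto simp: full_hc full_Vr h(2)\<close>)
      then show ?thesis using True by (simp add: full_Vc)
    qed (use that(1) in \<open>auto simp: hc_def PiE_def extensional_def\<close>)
  qed
  define q where "q = restrict (flow h) (parcs G)"
  have witness: "hc \<in> Vc \<rightarrow>\<^sub>E UNIV" "q \<in> parcs G \<rightarrow>\<^sub>E UNIV"
    by (simp_all add: hc_def q_def)
  have solves: "physically_correct G Vc resist (full hc, q, d)"
    using correct[OF witness(2), of hc] h(3) by (simp add: full_hc q_def)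
  have only: "hc' = hc \<and> q' = q"
    if "hc' \<in> Vc \<rightarrow>\<^sub>E UNIV" "q' \<in> parcs G \<rightarrow>\<^sub>E UNIV" "physically_correct G Vc resist (full hc', q', d)" for hc' q'
    using that correct unique full_hc unfolding q_def by metis
  show ?thesis
    unfolding full_def[symmetric]
  proof (rule ex1I)
    show "case (hc, q) of (hc, q) \<Rightarrow> (hc, q) \<in> (Vc \<rightarrow>\<^sub>E UNIV) \<times> (parcs G \<rightarrow>\<^sub>E UNIV) \<and>
        physically_correct G Vc resist (full hc, q, d)"
      using witness solves by simp
  next
    fix p
    assume "case p of (hc, q) \<Rightarrow> (hc, q) \<in> (Vc \<rightarrow>\<^sub>E UNIV) \<times> (parcs G \<rightarrow>\<^sub>E UNIV) \<and>
        physically_correct G Vc resist (full hc, q, d)"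
    then show "p = (hc, q)"
      using only[of "fst p" "snd p"] by (simp add: case_prod_unfold mem_Times_iff prod_eq_iff)
  qed
qed

end
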